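(* Suppose that $K_p$ and $K_c$ have no common discontinuity points and $K_p(t)<1$, $K_c(t)<1$ for all $t\ge0$. Then the probability of non-ruin $\varphi(u)=P\{\xi_t\ge0\ \forall t\ge 0\mid \xi_0=u\}$ of the process $\xi_t$ described in the context satisfies, for all $u\ge0$, $$\varphi(u)=\int_0^\infty\!\int_0^{U(u,t)}\varphi(U(u,t)-z)\,dF(z)\,(1-K_p(t))\,dK_c(t)+\int_0^\infty\!\int_0^{+\infty}\varphi(U(u,t)+z)\,dG(z)\,(1-K_c(t))\,dK_p(t).$$
   Context: $F$ and $G$ are the distribution functions of nonnegative random variables (claims and premiums respectively); $K_c$, $K_p$ are distribution functions of nonnegative random variables; $c:[0,+\infty)\to[0,+\infty)$ is piecewise continuous and $U(u,t)$ is the solution of the Cauchy problem $dU/dt=c(U)$, $U(u,0)=u$, assumed uniquely defined for all $u,t\ge0$. The capital process $\xi_t$ with $\xi_0=u$ is constructed as follows. At the initial moment and at each jump moment $t'$, independent random variables $\tau_p$ and $\tau_c$ with distribution functions $K_p$ and $K_c$ are generated, independently of the past. The next jump occurs at $t''=t'+\min\{\tau_p,\tau_c\}$. If $\tau_p<\tau_c$, the capital increases at $t''$ by a random premium with distribution $G$; otherwise it decreases by a random claim with distribution $F$; premiums and claims are independent of each other and of everything else. Between jumps the capital evolves by $d\xi_t/dt=c(\xi_t)$. Ruin is the event that the capital is negative at some time (including immediately after some jump). Integrals are Lebesgue–Stieltjes integrals with endpoints included. *)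

theory Defs
  imports "HOL-Probability.Probability"
begin

definition piecewise_continuous_nonneg :: "(real \<Rightarrow> real) \<Rightarrow> bool" where
  "piecewise_continuous_nonneg c \<longleftrightarrow>
     (\<exists>D. (\<forall>R. finite (D \<inter> {0..R})) \<and>
          (\<forall>x\<in>{0..} - D. continuous (at x within {0..}) c) \<and>
          (\<forall>x\<in>D \<inter> {0..}. (\<exists>l. (c \<longlongrightarrow> l) (at_right x)) \<and>
                          (0 < x \<longrightarrow> (\<exists>l. (c \<longlongrightarrow> l) (at_left x)))))"

text \<open>
  Since \<open>c\<close> may jump, a solution of \<open>dy/dt = c(y)\<close> is a continuous function that satisfies
  the equation outside a locally finite set of times.  The constraint \<open>0 \<le> y t\<close> reflects
  that \<open>c\<close> is only meaningful on \<open>[0, \<infinity>)\<close>.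
\<close>

definition cauchy_solution :: "(real \<Rightarrow> real) \<Rightarrow> real \<Rightarrow> (real \<Rightarrow> real) \<Rightarrow> bool" where
  "cauchy_solution c u y \<longleftrightarrow>
     y 0 = u \<and> continuous_on {0..} y \<and> (\<forall>t\<ge>0. 0 \<le> y t) \<and>
     (\<exists>D. (\<forall>R. finite (D \<inter> {0..R})) \<and>
          (\<forall>t\<in>{0..} - D. (y has_real_derivative c (y t)) (at t within {0..})))"

definition unique_cauchy_flow :: "(real \<Rightarrow> real) \<Rightarrow> (real \<Rightarrow> real \<Rightarrow> real) \<Rightarrow> bool" where
  "unique_cauchy_flow c U \<longleftrightarrow>
     (\<forall>u\<ge>0. cauchy_solution c u (U u) \<and>
            (\<forall>y. cauchy_solution c u y \<longrightarrow> (\<forall>t\<ge>0. y t = U u t)))"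

text \<open>
  The \<open>n\<close>-th entries \<open>\<tau>p n\<close>, \<open>\<tau>c n\<close> are the two waiting times generated at the \<open>n\<close>-th jump
  (at time \<open>0\<close> for \<open>n = 0\<close>); \<open>X n\<close> and \<open>Y n\<close> are the premium and the claim of which one
  is used at jump \<open>n + 1\<close>.
\<close>

datatype input_kind = Premium_Time | Claim_Time | Premium_Size | Claim_Size

fun risk_inputs ::
  "(nat \<Rightarrow> 'a \<Rightarrow> real) \<Rightarrow> (nat \<Rightarrow> 'a \<Rightarrow> real) \<Rightarrow> (nat \<Rightarrow> 'a \<Rightarrow> real) \<Rightarrow> (nat \<Rightarrow> 'a \<Rightarrow> real) \<Rightarrow>
   input_kind \<times> nat \<Rightarrow> 'a \<Rightarrow> real" where
  "risk_inputs \<tau>p \<tau>c X Y (Premium_Time, n) = \<tau>p n"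
| "risk_inputs \<tau>p \<tau>c X Y (Claim_Time, n) = \<tau>c n"
| "risk_inputs \<tau>p \<tau>c X Y (Premium_Size, n) = X n"
| "risk_inputs \<tau>p \<tau>c X Y (Claim_Size, n) = Y n"

text \<open>
  Capital has no prescribed dynamics below \<open>0\<close>; it is kept constant there.  The choice does
  not affect ruin, which has already occurred at that point.
\<close>

definition drift :: "(real \<Rightarrow> real \<Rightarrow> real) \<Rightarrow> real \<Rightarrow> real \<Rightarrow> real" where
  "drift U x t = (if 0 \<le> x then U x t else x)"

primrec jump_time ::
  "(nat \<Rightarrow> 'a \<Rightarrow> real) \<Rightarrow> (nat \<Rightarrow> 'a \<Rightarrow> real) \<Rightarrow> 'a \<Rightarrow> nat \<Rightarrow> real" where
  "jump_time \<tau>p \<tau>c \<omega> 0 = 0"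
| "jump_time \<tau>p \<tau>c \<omega> (Suc n) = jump_time \<tau>p \<tau>c \<omega> n + min (\<tau>p n \<omega>) (\<tau>c n \<omega>)"

primrec post_jump_capital ::
  "(real \<Rightarrow> real \<Rightarrow> real) \<Rightarrow> (nat \<Rightarrow> 'a \<Rightarrow> real) \<Rightarrow> (nat \<Rightarrow> 'a \<Rightarrow> real) \<Rightarrow>
   (nat \<Rightarrow> 'a \<Rightarrow> real) \<Rightarrow> (nat \<Rightarrow> 'a \<Rightarrow> real) \<Rightarrow> real \<Rightarrow> 'a \<Rightarrow> nat \<Rightarrow> real" where
  "post_jump_capital U \<tau>p \<tau>c X Y u \<omega> 0 = u"
| "post_jump_capital U \<tau>p \<tau>c X Y u \<omega> (Suc n) =
     (let x = drift U (post_jump_capital U \<tau>p \<tau>c X Y u \<omega> n) (min (\<tau>p n \<omega>) (\<tau>c n \<omega>))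
      in if \<tau>p n \<omega> < \<tau>c n \<omega> then x + X n \<omega> else x - Y n \<omega>)"

text \<open>
  For \<open>t \<ge> 0\<close> and nonnegative waiting times, the least \<open>n\<close> below is the unique one with
  \<open>T\<^sub>n \<le> t < T\<^sub>n\<^sub>+\<^sub>1\<close>.  The value \<open>0\<close> is a convention for times beyond an
  accumulation point of the jump times.
\<close>

definition capital ::
  "(real \<Rightarrow> real \<Rightarrow> real) \<Rightarrow> (nat \<Rightarrow> 'a \<Rightarrow> real) \<Rightarrow> (nat \<Rightarrow> 'a \<Rightarrow> real) \<Rightarrow>
   (nat \<Rightarrow> 'a \<Rightarrow> real) \<Rightarrow> (nat \<Rightarrow> 'a \<Rightarrow> real) \<Rightarrow> real \<Rightarrow> 'a \<Rightarrow> real \<Rightarrow> real" where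
  "capital U \<tau>p \<tau>c X Y u \<omega> t =
     (if \<exists>n. t < jump_time \<tau>p \<tau>c \<omega> (Suc n)
      then let n = (LEAST n. t < jump_time \<tau>p \<tau>c \<omega> (Suc n))
           in drift U (post_jump_capital U \<tau>p \<tau>c X Y u \<omega> n) (t - jump_time \<tau>p \<tau>c \<omega> n)
      else 0)"

text \<open>
  The condition on the capital after each jump is not implied by the one on \<open>capital\<close>: when
  several jumps occur at the same instant, only the last value is seen by \<open>capital\<close>.
\<close>

definition nonruin_probability ::
  "'a measure \<Rightarrow> (real \<Rightarrow> real \<Rightarrow> real) \<Rightarrow> (nat \<Rightarrow> 'a \<Rightarrow> real) \<Rightarrow> (nat \<Rightarrow> 'a \<Rightarrow> real) \<Rightarrow>
   (nat \<Rightarrow> 'a \<Rightarrow> real) \<Rightarrow> (nat \<Rightarrow> 'a \<Rightarrow> real) \<Rightarrow> real \<Rightarrow> real" where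
  "nonruin_probability M U \<tau>p \<tau>c X Y u =
     measure M {\<omega> \<in> space M. (\<forall>t\<ge>0. 0 \<le> capital U \<tau>p \<tau>c X Y u \<omega> t) \<and>
                             (\<forall>n. 0 \<le> post_jump_capital U \<tau>p \<tau>c X Y u \<omega> n)}"

end

theory Submission
  imports Defs
begin

text \<open>
  By uniqueness, solutions of the Cauchy problem cannot cross, so \<open>U x t\<close> is monotone in \<open>x\<close>;
  being continuous in \<open>t\<close>, it is jointly measurable.  Between jumps the capital stays nonnegative,
  hence survival depends only on the post-jump capitals, and these depend measurably on the initial
  capital and the sequence of inputs.  After the first jump the process starts afresh: the
  remaining inputs are independent of the first ones and have the law of the whole sequence.
  Integrating them out by Fubini's theorem leaves \<open>\<phi>\<close> evaluated at the capital after the first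
  jump.  In the claim term this produces \<open>P(\<tau>p \<ge> t)\<close>, which equals \<open>1 - Kp t\<close> for
  \<open>Kc\<close>-almost every \<open>t\<close> since the countably many atoms of \<open>Kp\<close> are not atoms of \<open>Kc\<close>.
\<close>

section \<open>Comparison and joint measurability of the flow\<close>

text \<open>The derivatives of \<open>y\<close> and \<open>z\<close> may disagree at the gluing time
  \<open>s\<close>, but \<open>cauchy_solution\<close> tolerates a locally finite exceptional set,
  to which \<open>s\<close> is added.\<close>

lemma cauchy_solution_splice:
  assumes y: "cauchy_solution c u y" and z: "cauchy_solution c v z"
    and s: "0 \<le> s" "y s = z s"
  shows "cauchy_solution c u (\<lambda>t. if t \<le> s then y t else z t)"
proof -
  let ?w = "\<lambda>t. if t \<le> s then y t else z t"
  from y obtain D where D: "\<And>R. finite (D \<inter> {0..R})"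
    "\<And>t. t \<in> {0..} - D \<Longrightarrow> (y has_real_derivative c (y t)) (at t within {0..})"
    unfolding cauchy_solution_def by blast
  from z obtain E where E: "\<And>R. finite (E \<inter> {0..R})"
    "\<And>t. t \<in> {0..} - E \<Longrightarrow> (z has_real_derivative c (z t)) (at t within {0..})"
    unfolding cauchy_solution_def by blast
  have "continuous_on ({0..s} \<union> {s..}) ?w"
    using y z s unfolding cauchy_solution_def
    by (intro continuous_on_If) (auto elim: continuous_on_subset)
  moreover have "{0..s} \<union> {s..} = {0..}" using s by auto
  ultimately have cont: "continuous_on {0..} ?w" by simp
  have fin: "finite ((D \<union> E \<union> {s}) \<inter> {0..R})" for R
  proof -
    have "(D \<union> E \<union> {s}) \<inter> {0..R} \<subseteq> (D \<inter> {0..R}) \<union> (E \<inter> {0..R}) \<union> {s}" by auto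
    then show ?thesis using D(1) E(1) by (meson finite.emptyI finite.insertI finite_UnI finite_subset)
  qed
  have deriv: "(?w has_real_derivative c (?w t)) (at t within {0..})"
    if t: "t \<in> {0..} - (D \<union> E \<union> {s})" for t
  proof (cases "t < s")
    case True
    have "(?w has_real_derivative c (y t)) (at t within {0..})"
      by (rule has_field_derivative_transform_within[OF D(2), where d = "s - t"])
         (use t True in \<open>auto simp: dist_real_def\<close>)
    then show ?thesis using True by simp
  next
    case False
    have "(?w has_real_derivative c (z t)) (at t within {0..})"
      by (rule has_field_derivative_transform_within[OF E(2), where d = "t - s"])
         (use t False in \<open>auto simp: dist_real_def\<close>)
    then show ?thesis using False t by auto
  qed
  show ?thesis
    unfolding cauchy_solution_def
    using y z s cont fin deriv unfolding cauchy_solution_def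
    by (intro conjI exI[of _ "D \<union> E \<union> {s}"]) auto
qed

text \<open>If \<open>U u\<close> exceeded \<open>U v\<close> at time \<open>t\<close>, the two
  would meet at some \<open>s \<le> t\<close> by the intermediate value theorem. Following
  \<open>U v\<close> from \<open>s\<close> on is then another solution from \<open>u\<close>,
  against uniqueness.\<close>

lemma unique_cauchy_flow_mono:
  assumes U: "unique_cauchy_flow c U" and uv: "0 \<le> u" "u \<le> v" and t: "0 \<le> t"
  shows "U u t \<le> U v t"
proof (rule ccontr)
  assume less: "\<not> U u t \<le> U v t"
  have sol: "cauchy_solution c u (U u)" "cauchy_solution c v (U v)"
    using U uv unfolding unique_cauchy_flow_def by auto
  have "continuous_on {0..t} (\<lambda>s. U u s - U v s)"
    using sol unfolding cauchy_solution_def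
    by (intro continuous_intros) (auto elim: continuous_on_subset)
  moreover have "U u 0 - U v 0 \<le> 0" "0 \<le> U u t - U v t"
    using sol uv less unfolding cauchy_solution_def by auto
  ultimately obtain s where s: "0 \<le> s" "s \<le> t" "U u s - U v s = 0"
    using IVT'[of "\<lambda>s. U u s - U v s" 0 0 t] t by auto
  have "cauchy_solution c u (\<lambda>t. if t \<le> s then U u t else U v t)"
    using sol s by (intro cauchy_solution_splice) auto
  moreover have "\<forall>y. cauchy_solution c u y \<longrightarrow> (\<forall>t\<ge>0. y t = U u t)"
    using U uv unfolding unique_cauchy_flow_def by simp
  ultimately have "(if t \<le> s then U u t else U v t) = U u t"
    using t by blast
  then show False using less s by (auto split: if_splits)
qed

text \<open>Rounding \<open>t\<close> down to a multiple of \<open>1 / (i + 1)\<close> leaves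
  countably many sections in \<open>x\<close>, each monotone and hence Borel, so the approximants
  are jointly measurable. Continuity in \<open>t\<close> makes them converge to
  \<open>f\<close>.\<close>

lemma measurable_mono_continuous:
  fixes f :: "real \<Rightarrow> real \<Rightarrow> real"
  assumes mono: "\<And>t. mono (\<lambda>x. f x t)" and cont: "\<And>x. continuous_on UNIV (f x)"
  shows "(\<lambda>(x, t). f x t) \<in> borel_measurable (borel \<Otimes>\<^sub>M borel)"
proof (rule borel_measurable_LIMSEQ_real)
  let ?a = "\<lambda>i t. real_of_int \<lfloor>real (Suc i) * t\<rfloor> / real (Suc i)"
  fix p :: "real \<times> real"
  obtain x t where p: "p = (x, t)" by (cases p)
  have "(\<lambda>i. ?a i t) \<longlonglongrightarrow> t"
  proof (rule LIMSEQ_I)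
    fix r :: real assume "0 < r"
    then obtain N :: nat where N: "inverse (real (Suc N)) < r"
      using reals_Archimedean by blast
    show "\<exists>no. \<forall>n\<ge>no. norm (?a n t - t) < r"
    proof (intro exI allI impI)
      fix n assume n: "N \<le> n"
      have "?a n t - t = (real_of_int \<lfloor>real (Suc n) * t\<rfloor> - real (Suc n) * t) / real (Suc n)"
        by (simp add: diff_divide_distrib del: of_nat_Suc)
      then have "\<bar>?a n t - t\<bar> = \<bar>real_of_int \<lfloor>real (Suc n) * t\<rfloor> - real (Suc n) * t\<bar> / real (Suc n)"
        by (simp only: abs_divide abs_of_nat)
      also have "\<dots> \<le> 1 / real (Suc n)"
        by (intro divide_right_mono) linarith+
      also have "\<dots> \<le> inverse (real (Suc N))"
        using n by (simp add: field_simps)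
      finally show "norm (?a n t - t) < r" using N by simp
    qed
  qed
  moreover have "isCont (f x) t"
    using cont[of x] by (simp add: continuous_on_eq_continuous_at)
  ultimately have "(\<lambda>i. f x (?a i t)) \<longlonglongrightarrow> f x t"
    using isCont_tendsto_compose by blast
  then show "(\<lambda>i. case p of (x, t) \<Rightarrow> f x (?a i t)) \<longlonglongrightarrow> (case p of (x, t) \<Rightarrow> f x t)"
    by (simp add: p)
next
  fix i
  have [measurable]: "(\<lambda>x. f x t) \<in> borel_measurable borel" for t
    by (rule borel_measurable_mono[OF mono])
  have "(\<lambda>p. f (fst p) (real_of_int \<lfloor>real (Suc i) * snd p\<rfloor> / real (Suc i)))
      \<in> borel_measurable (borel \<Otimes>\<^sub>M borel)"
    by (rule measurable_compose_countable[where g = "\<lambda>p. \<lfloor>real (Suc i) * snd p\<rfloor>"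
          and f = "\<lambda>k p. f (fst p) (real_of_int k / real (Suc i))"]) measurable
  then show "(\<lambda>p. case p of (x, t) \<Rightarrow> f x (real_of_int \<lfloor>real (Suc i) * t\<rfloor> / real (Suc i)))
      \<in> borel_measurable (borel \<Otimes>\<^sub>M borel)"
    by (simp add: case_prod_beta')
qed

text \<open>Freezing the capital below \<open>0\<close> preserves monotonicity because
  \<open>U y\<close> is nonnegative for \<open>y \<ge> 0\<close>; clipping the time makes the
  sections continuous on the whole line.\<close>

lemma drift_flow_measurable:
  assumes "unique_cauchy_flow c U"
  shows "(\<lambda>(x, t). drift U x (max 0 t)) \<in> borel_measurable (borel \<Otimes>\<^sub>M borel)"
proof (rule measurable_mono_continuous)
  have nonneg: "0 \<le> U x t" if "0 \<le> x" "0 \<le> t" for x t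
    using assms that unfolding unique_cauchy_flow_def cauchy_solution_def by auto
  show "mono (\<lambda>x. drift U x (max 0 t))" for t
  proof (rule monoI)
    fix x y :: real assume "x \<le> y"
    then show "drift U x (max 0 t) \<le> drift U y (max 0 t)"
      using unique_cauchy_flow_mono[OF assms, of x y "max 0 t"] nonneg[of y "max 0 t"]
      unfolding drift_def by auto
  qed
  show "continuous_on UNIV (\<lambda>t. drift U x (max 0 t))" for x
  proof (cases "0 \<le> x")
    case True
    then have "continuous_on {0..} (U x)"
      using assms unfolding unique_cauchy_flow_def cauchy_solution_def by auto
    then have "continuous_on UNIV (\<lambda>t. U x (max 0 t))"
      by (rule continuous_on_compose2) (auto intro!: continuous_intros)
    then show ?thesis using True by (simp add: drift_def)
  qed (simp add: drift_def)
qed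

text \<open>Identifies the laws of the inputs with the Stieltjes integrators of the theorem.\<close>

lemma (in real_distribution) interval_measure_cdf: "interval_measure (cdf M) = M"
proof (rule cdf_unique)
  show "real_distribution (interval_measure (cdf M))"
    by (intro real_distribution_interval_measure cdf_nondecreasing cdf_is_right_cont
        cdf_lim_at_bot cdf_lim_at_top_prob)
  show "cdf (interval_measure (cdf M)) = cdf M"
    by (intro cdf_interval_measure cdf_nondecreasing cdf_is_right_cont
        cdf_lim_at_bot cdf_lim_at_top_prob)
qed unfold_locales

text \<open>
  The capital process on the canonical space of input sequences.  Clipping times at \<open>0\<close> makes
  it measurable there: \<open>U x t\<close> is unconstrained for \<open>t < 0\<close>.
\<close>

definition input_capital ::
  "(real \<Rightarrow> real \<Rightarrow> real) \<Rightarrow> real \<Rightarrow> (input_kind \<times> nat \<Rightarrow> real) \<Rightarrow> nat \<Rightarrow> real" where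
  "input_capital U = post_jump_capital (\<lambda>x t. U x (max 0 t))
     (\<lambda>n w. w (Premium_Time, n)) (\<lambda>n w. w (Claim_Time, n))
     (\<lambda>n w. w (Premium_Size, n)) (\<lambda>n w. w (Claim_Size, n))"

text \<open>A set of pairs rather than a family of sets, because Fubini's theorem at a random
  restart capital requires measurability jointly in capital and inputs.\<close>

definition survival_set :: "(real \<Rightarrow> real \<Rightarrow> real) \<Rightarrow> (real \<times> (input_kind \<times> nat \<Rightarrow> real)) set" where
  "survival_set U = {(x, w). \<forall>n. 0 \<le> input_capital U x w n}"

section \<open>Restart after a jump and measurability of survival\<close>

lemma input_capital_0 [simp]: "input_capital U x w 0 = x"
  by (simp add: input_capital_def)

lemma input_capital_Suc:
  "input_capital U x w (Suc n) =
     (let y = drift U (input_capital U x w n) (max 0 (min (w (Premium_Time, n)) (w (Claim_Time, n))))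
      in if w (Premium_Time, n) < w (Claim_Time, n) then y + w (Premium_Size, n)
         else y - w (Claim_Size, n))"
  by (simp add: input_capital_def drift_def Let_def)

text \<open>The recursion is homogeneous: step \<open>n + 1\<close> on \<open>w\<close> reads the
  same entries as step \<open>n\<close> on the shifted sequence.\<close>

lemma input_capital_shift:
  "input_capital U x w (Suc n) =
     input_capital U (input_capital U x w (Suc 0)) (\<lambda>i. w (fst i, Suc (snd i))) n"
proof (induction n)
  case 0
  show ?case by simp
next
  case (Suc n)
  show ?case
    by (subst (1) input_capital_Suc, subst (3) input_capital_Suc) (simp add: Suc Let_def)
qed

text \<open>First-step analysis along a single path; taking expectations of this equivalence leads
  to the integral equation.\<close>

lemma survival_set_step:
  "(x, w) \<in> survival_set U \<longleftrightarrow>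
     0 \<le> x \<and> (input_capital U x w (Suc 0), \<lambda>i. w (fst i, Suc (snd i))) \<in> survival_set U"
proof -
  have "(\<forall>n. 0 \<le> input_capital U x w n) \<longleftrightarrow> 0 \<le> x \<and> (\<forall>n. 0 \<le> input_capital U x w (Suc n))"
    by (metis input_capital_0 old.nat.exhaust)
  then show ?thesis
    unfolding survival_set_def by (simp add: input_capital_shift[symmetric])
qed

lemma input_capital_measurable:
  assumes U: "unique_cauchy_flow c U"
  shows "(\<lambda>p. input_capital U (fst p) (snd p) n)
           \<in> borel_measurable (borel \<Otimes>\<^sub>M (\<Pi>\<^sub>M i\<in>UNIV. borel))"
proof (induction n)
  case 0
  show ?case by simp
next
  case (Suc n)
  note [measurable] = Suc
  have [measurable]: "(\<lambda>p. snd p i) \<in> borel_measurable (borel \<Otimes>\<^sub>M (\<Pi>\<^sub>M i\<in>UNIV. borel))"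
    for i :: "input_kind \<times> nat"
    by (rule measurable_compose[OF measurable_snd]) simp
  \<comment> \<open>Both the state and the time fed to the flow depend on the point
    \<open>p\<close>, so separate measurability of the flow would not suffice.\<close>
  have [measurable]: "(\<lambda>p. drift U (input_capital U (fst p) (snd p) n)
        (max 0 (min (snd p (Premium_Time, n)) (snd p (Claim_Time, n)))))
      \<in> borel_measurable (borel \<Otimes>\<^sub>M (\<Pi>\<^sub>M i\<in>UNIV. borel))"
    using measurable_compose[OF _ drift_flow_measurable[OF U], of "\<lambda>p. (input_capital U (fst p) (snd p) n,
        min (snd p (Premium_Time, n)) (snd p (Claim_Time, n)))"]
    by simp
  show ?case
    unfolding input_capital_Suc Let_def by measurable
qed

lemma survival_set_measurable:
  assumes "unique_cauchy_flow c U"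
  shows "survival_set U \<in> sets (borel \<Otimes>\<^sub>M (\<Pi>\<^sub>M i\<in>UNIV. borel))"
proof -
  note [measurable] = input_capital_measurable[OF assms]
  have "{p \<in> space (borel \<Otimes>\<^sub>M (\<Pi>\<^sub>M i\<in>UNIV. borel)). \<forall>n. 0 \<le> input_capital U (fst p) (snd p) n}
      \<in> sets (borel \<Otimes>\<^sub>M (\<Pi>\<^sub>M i\<in>UNIV. borel))"
    by measurable
  also have "{p \<in> space (borel \<Otimes>\<^sub>M (\<Pi>\<^sub>M i\<in>UNIV. borel)). \<forall>n. 0 \<le> input_capital U (fst p) (snd p) n}
      = survival_set U"
    by (auto simp: survival_set_def space_pair_measure space_PiM)
  finally show ?thesis .
qed

lemma post_jump_capital_eq_input_capital:
  assumes "\<And>i. 0 \<le> risk_inputs \<tau>p \<tau>c X Y i \<omega>"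
  shows "post_jump_capital U \<tau>p \<tau>c X Y u \<omega> n =
         input_capital U u (\<lambda>i. risk_inputs \<tau>p \<tau>c X Y i \<omega>) n"
proof (induction n)
  case 0
  show ?case by simp
next
  case (Suc n)
  have "0 \<le> \<tau>p n \<omega>" "0 \<le> \<tau>c n \<omega>"
    using assms[of "(Premium_Time, n)"] assms[of "(Claim_Time, n)"] by auto
  then show ?case
    using Suc by (simp add: input_capital_Suc max_absorb2 Let_def)
qed

lemma capital_nonneg:
  assumes U: "unique_cauchy_flow c U" and t: "0 \<le> t"
    and post: "\<And>n. 0 \<le> post_jump_capital U \<tau>p \<tau>c X Y u \<omega> n"
  shows "0 \<le> capital U \<tau>p \<tau>c X Y u \<omega> t"
proof (cases "\<exists>n. t < jump_time \<tau>p \<tau>c \<omega> (Suc n)")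
  case True
  define n where "n = (LEAST n. t < jump_time \<tau>p \<tau>c \<omega> (Suc n))"
  \<comment> \<open>Minimality excludes the index before \<open>n\<close>, so the elapsed time
    passed to \<open>U\<close> is nonnegative, where \<open>U\<close> is known to stay above
    \<open>0\<close>.\<close>
  have "jump_time \<tau>p \<tau>c \<omega> n \<le> t"
  proof (cases n)
    case (Suc m)
    then have "\<not> t < jump_time \<tau>p \<tau>c \<omega> (Suc m)"
      unfolding n_def by (metis lessI not_less_Least)
    then show ?thesis using Suc by simp
  qed (use t in simp)
  then have "0 \<le> U (post_jump_capital U \<tau>p \<tau>c X Y u \<omega> n) (t - jump_time \<tau>p \<tau>c \<omega> n)"
    using U post[of n] unfolding unique_cauchy_flow_def cauchy_solution_def by simp
  then show ?thesis
    using True post[of n] unfolding capital_def n_def[symmetric] by (simp add: drift_def Let_def)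
next
  \<comment> \<open>Past an accumulation point of the jump times \<open>capital\<close> takes its
    default value \<open>0\<close>, which counts as survival.\<close>
  case False
  then show ?thesis unfolding capital_def by (simp del: jump_time.simps)
qed

section \<open>Independence and Fubini's theorem at the first jump\<close>

lemma integral_pair_bounded:
  fixes f :: "'a \<times> 'b \<Rightarrow> real"
  assumes "prob_space A" "prob_space B" and f: "f \<in> borel_measurable (A \<Otimes>\<^sub>M B)"
    and bound: "\<And>p. \<bar>f p\<bar> \<le> C"
  shows "integral\<^sup>L (A \<Otimes>\<^sub>M B) f = (\<integral>x. \<integral>y. f (x, y) \<partial>B \<partial>A)"
proof -
  interpret A: prob_space A by fact
  interpret B: prob_space B by fact
  interpret AB: pair_prob_space A B ..
  have "integrable (A \<Otimes>\<^sub>M B) f"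
    using f bound by (intro AB.P.integrable_const_bound[where B = C]) auto
  then show ?thesis by (simp add: AB.integral_fst')
qed

text \<open>Disjoint blocks of independent variables have a product law, and applying
  \<open>f\<close> to one factor and \<open>g\<close> to the other keeps it a product.\<close>

lemma (in prob_space) distr_pair_coordinates:
  assumes X: "indep_vars M' X I" "A \<inter> B = {}" "A \<subseteq> I" "B \<subseteq> I"
    and f[measurable]: "f \<in> measurable (PiM A M') N1" and g[measurable]: "g \<in> measurable (PiM B M') N2"
  shows "distr M (N1 \<Otimes>\<^sub>M N2) (\<lambda>\<omega>. (f (restrict (\<lambda>i. X i \<omega>) A), g (restrict (\<lambda>i. X i \<omega>) B))) =
    distr M N1 (\<lambda>\<omega>. f (restrict (\<lambda>i. X i \<omega>) A)) \<Otimes>\<^sub>M distr M N2 (\<lambda>\<omega>. g (restrict (\<lambda>i. X i \<omega>) B))"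
proof -
  let ?A = "\<lambda>\<omega>. restrict (\<lambda>i. X i \<omega>) A" and ?B = "\<lambda>\<omega>. restrict (\<lambda>i. X i \<omega>) B"
  have rv[measurable]: "random_variable (PiM A M') ?A" "random_variable (PiM B M') ?B"
    and eq: "distr M (PiM A M') ?A \<Otimes>\<^sub>M distr M (PiM B M') ?B =
      distr M (PiM A M' \<Otimes>\<^sub>M PiM B M') (\<lambda>\<omega>. (?A \<omega>, ?B \<omega>))"
    using indep_var_restrict[OF X] by (auto simp: indep_var_distribution_eq)
  have "prob_space (distr (distr M (PiM B M') ?B) N2 g)"
    by (intro prob_space.prob_space_distr prob_space_distr) auto
  then have sf: "sigma_finite_measure (distr (distr M (PiM B M') ?B) N2 g)"
    using prob_space_imp_sigma_finite by blast
  have "distr (distr M (PiM A M') ?A) N1 f \<Otimes>\<^sub>M distr (distr M (PiM B M') ?B) N2 g =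
      distr (distr M (PiM A M') ?A \<Otimes>\<^sub>M distr M (PiM B M') ?B) (N1 \<Otimes>\<^sub>M N2) (\<lambda>(x, y). (f x, g y))"
    by (rule pair_measure_distr) (use sf in auto)
  then show ?thesis
    unfolding eq by (simp add: distr_distr comp_def)
qed

text \<open>Serves both kinds of jump: \<open>T\<close> is the clock that rings first,
  \<open>T'\<close> its competitor, \<open>Z\<close> the jump size, \<open>S\<close> the later
  inputs, \<open>h\<close> the capital after the jump, and \<open>R\<close> encodes the rule for
  ties. The variable \<open>T'\<close> enters only through \<open>R\<close>, so its integral factors
  out as a probability depending on \<open>t\<close>.\<close>

lemma (in prob_space) expectation_first_jump:
  fixes T T' Z :: "'a \<Rightarrow> real" and S :: "'a \<Rightarrow> 'b" and h :: "real \<Rightarrow> real \<Rightarrow> real"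
  assumes rv[measurable]: "random_variable borel T" "random_variable borel T'"
      "random_variable borel Z" "random_variable N S"
    and D: "distr M (borel \<Otimes>\<^sub>M (borel \<Otimes>\<^sub>M (borel \<Otimes>\<^sub>M N))) (\<lambda>\<omega>. (T \<omega>, T' \<omega>, Z \<omega>, S \<omega>)) =
      distr M borel T \<Otimes>\<^sub>M (distr M borel T' \<Otimes>\<^sub>M (distr M borel Z \<Otimes>\<^sub>M distr M N S))"
    and R: "{p. R (fst p) (snd p)} \<in> sets (borel \<Otimes>\<^sub>M borel)"
    and A[measurable]: "A \<in> sets (borel \<Otimes>\<^sub>M N)"
    and h: "(\<lambda>(t, z). h t z) \<in> borel_measurable (borel \<Otimes>\<^sub>M borel)"
  shows "expectation (\<lambda>\<omega>. of_bool (R (T \<omega>) (T' \<omega>)) * indicat_real A (h (T \<omega>) (Z \<omega>), S \<omega>)) =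
    (\<integral>t. (\<integral>z. (\<integral>s. indicat_real A (h t z, s) \<partial>distr M N S) \<partial>distr M borel Z)
         * measure (distr M borel T') {t'. R t t'} \<partial>distr M borel T)"
proof -
  let ?T = "distr M borel T" and ?T' = "distr M borel T'" and ?Z = "distr M borel Z"
    and ?S = "distr M N S"
  have P: "prob_space ?T" "prob_space ?T'" "prob_space ?Z" "prob_space ?S"
    by (intro prob_space_distr; simp)+
  interpret T: prob_space ?T by fact
  interpret T': prob_space ?T' by fact
  interpret Z: prob_space ?Z by fact
  interpret S: prob_space ?S by fact
  interpret ZS: pair_prob_space ?Z ?S ..
  interpret TZS: pair_prob_space ?T' "?Z \<Otimes>\<^sub>M ?S" ..
  let ?r = "\<lambda>t t'. of_bool (R t t') :: real"
  have [measurable]: "(\<lambda>p. of_bool (R (fst p) (snd p)) :: real) \<in> borel_measurable (borel \<Otimes>\<^sub>M borel)"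
  proof -
    have "(\<lambda>p. of_bool (R (fst p) (snd p)) :: real) = indicator {p. R (fst p) (snd p)}"
      by (auto simp: indicator_def)
    then show ?thesis using R by simp
  qed
  have r: "(\<lambda>x. ?r (f x) (g x)) \<in> borel_measurable K"
    if "f \<in> borel_measurable K" "g \<in> borel_measurable K" for f g and K :: "'c measure"
    using measurable_compose[OF measurable_Pair[OF that], of "\<lambda>p. ?r (fst p) (snd p)"] by simp
  have hm: "(\<lambda>x. h (f x) (g x)) \<in> borel_measurable K"
    if "f \<in> borel_measurable K" "g \<in> borel_measurable K" for f g and K :: "'c measure"
    using measurable_compose[OF measurable_Pair[OF that] h] by simp
  let ?g = "\<lambda>(t, t', z, s). ?r t t' * indicat_real A (h t z, s)"
  have g: "?g \<in> borel_measurable (borel \<Otimes>\<^sub>M (borel \<Otimes>\<^sub>M (borel \<Otimes>\<^sub>M N)))"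
    unfolding case_prod_beta'
    by (intro borel_measurable_times r measurable_compose[OF measurable_Pair borel_measurable_indicator[OF A]] hm)
       measurable
  have gt: "(\<lambda>(t', z, s). ?r t t' * indicat_real A (h t z, s))
      \<in> borel_measurable (borel \<Otimes>\<^sub>M (borel \<Otimes>\<^sub>M N))" for t
    unfolding case_prod_beta'
    by (intro borel_measurable_times r measurable_compose[OF measurable_Pair borel_measurable_indicator[OF A]] hm)
       measurable
  have gz: "(\<lambda>(z, s). indicat_real A (h t z, s)) \<in> borel_measurable (borel \<Otimes>\<^sub>M N)" for t
    unfolding case_prod_beta'
    by (intro measurable_compose[OF measurable_Pair borel_measurable_indicator[OF A]] hm) measurable
  have bd: "\<bar>?r t t' * indicat_real A q\<bar> \<le> 1" for t t' q
    by (auto simp: indicator_def)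
  have inner: "(\<integral>p. (case p of (t', z, s) \<Rightarrow> ?r t t' * indicat_real A (h t z, s))
        \<partial>(?T' \<Otimes>\<^sub>M (?Z \<Otimes>\<^sub>M ?S))) =
      (\<integral>z. (\<integral>s. indicat_real A (h t z, s) \<partial>?S) \<partial>?Z) * measure ?T' {t'. R t t'}" for t
  proof -
    have set: "{t'. R t t'} \<in> sets borel"
      using sets_Pair1[OF R, of t] by (simp add: vimage_def)
    have "(\<integral>p. (case p of (t', z, s) \<Rightarrow> ?r t t' * indicat_real A (h t z, s))
        \<partial>(?T' \<Otimes>\<^sub>M (?Z \<Otimes>\<^sub>M ?S))) =
      (\<integral>t'. \<integral>(z, s). ?r t t' * indicat_real A (h t z, s) \<partial>(?Z \<Otimes>\<^sub>M ?S) \<partial>?T')"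
      using gt bd
      by (subst integral_pair_bounded[where C = 1]) (auto intro: P ZS.P.prob_space_axioms)
    also have "\<dots> = (\<integral>t'. ?r t t' * (\<integral>(z, s). indicat_real A (h t z, s) \<partial>(?Z \<Otimes>\<^sub>M ?S)) \<partial>?T')"
      by (simp add: case_prod_beta')
    also have "\<dots> = (\<integral>t'. ?r t t' \<partial>?T') * (\<integral>(z, s). indicat_real A (h t z, s) \<partial>(?Z \<Otimes>\<^sub>M ?S))"
      by simp
    also have "(\<integral>t'. ?r t t' \<partial>?T') = (\<integral>t'. indicator {t'. R t t'} t' \<partial>?T')"
      by (intro Bochner_Integration.integral_cong) (auto simp: indicator_def)
    also have "\<dots> = measure ?T' {t'. R t t'}"
      using set by simp
    also have "(\<integral>(z, s). indicat_real A (h t z, s) \<partial>(?Z \<Otimes>\<^sub>M ?S)) =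
        (\<integral>z. (\<integral>s. indicat_real A (h t z, s) \<partial>?S) \<partial>?Z)"
      using gz
      by (subst integral_pair_bounded[where C = 1]) (auto intro: P simp: indicator_def)
    finally show ?thesis by simp
  qed
  have "expectation (\<lambda>\<omega>. ?r (T \<omega>) (T' \<omega>) * indicat_real A (h (T \<omega>) (Z \<omega>), S \<omega>)) =
      integral\<^sup>L (?T \<Otimes>\<^sub>M (?T' \<Otimes>\<^sub>M (?Z \<Otimes>\<^sub>M ?S))) ?g"
    unfolding D[symmetric] using g by (subst integral_distr) auto
  also have "\<dots> = (\<integral>t. \<integral>p. (case p of (t', z, s) \<Rightarrow> ?r t t' * indicat_real A (h t z, s))
        \<partial>(?T' \<Otimes>\<^sub>M (?Z \<Otimes>\<^sub>M ?S)) \<partial>?T)"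
    using g bd
    by (subst integral_pair_bounded[where C = 1]) (auto intro: P TZS.P.prob_space_axioms)
  finally show ?thesis by (simp add: inner)
qed

text \<open>Each equation of the proof splits one coordinate from its complement. Since
  \<open>S\<close> reads only successor indices, it is a function of each of these
  complements.\<close>

lemma (in prob_space) distr_first_inputs:
  fixes W :: "'k \<times> nat \<Rightarrow> 'a \<Rightarrow> real"
  assumes W: "indep_vars (\<lambda>_. borel) W UNIV" and k: "k1 \<noteq> k2" "k1 \<noteq> k3" "k2 \<noteq> k3"
  defines "N \<equiv> \<Pi>\<^sub>M i\<in>(UNIV :: ('k \<times> nat) set). (borel :: real measure)"
    and "S \<equiv> \<lambda>\<omega> i. W (fst i, Suc (snd i)) \<omega>"
  shows "distr M (borel \<Otimes>\<^sub>M (borel \<Otimes>\<^sub>M (borel \<Otimes>\<^sub>M N))) (\<lambda>\<omega>. (W (k1, 0) \<omega>, W (k2, 0) \<omega>, W (k3, 0) \<omega>, S \<omega>)) =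
    distr M borel (W (k1, 0)) \<Otimes>\<^sub>M
      (distr M borel (W (k2, 0)) \<Otimes>\<^sub>M (distr M borel (W (k3, 0)) \<Otimes>\<^sub>M distr M N S))"
proof -
  have coord: "(\<lambda>w. w i) \<in> borel_measurable (\<Pi>\<^sub>M i\<in>B. (borel :: real measure))"
    if "i \<in> B" for i :: "'k \<times> nat" and B
    using that by simp
  have shift: "(\<lambda>w i. w (fst i, Suc (snd i))) \<in> measurable (\<Pi>\<^sub>M i\<in>B. (borel :: real measure)) N"
    if "\<And>k n. (k, Suc n) \<in> B" for B :: "('k \<times> nat) set"
    unfolding N_def using that by (intro measurable_PiM_single') (auto intro!: coord)
  let ?A1 = "{(k1, 0::nat)}" and ?A2 = "{(k2, 0::nat)}" and ?A3 = "{(k3, 0::nat)}"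
  let ?s = "\<lambda>(w :: 'k \<times> nat \<Rightarrow> real) i. w (fst i, Suc (snd i))"
  have "distr M (borel \<Otimes>\<^sub>M (borel \<Otimes>\<^sub>M (borel \<Otimes>\<^sub>M N))) (\<lambda>\<omega>. (W (k1, 0) \<omega>, W (k2, 0) \<omega>, W (k3, 0) \<omega>, S \<omega>)) =
    distr M borel (W (k1, 0)) \<Otimes>\<^sub>M
      distr M (borel \<Otimes>\<^sub>M (borel \<Otimes>\<^sub>M N)) (\<lambda>\<omega>. (W (k2, 0) \<omega>, W (k3, 0) \<omega>, S \<omega>))"
    using distr_pair_coordinates[OF W, of ?A1 "- ?A1" "\<lambda>w. w (k1, 0)" borel
        "\<lambda>w. (w (k2, 0), w (k3, 0), ?s w)" "borel \<Otimes>\<^sub>M (borel \<Otimes>\<^sub>M N)"] k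
    by (simp add: S_def coord shift measurable_Pair)
  also have "distr M (borel \<Otimes>\<^sub>M (borel \<Otimes>\<^sub>M N)) (\<lambda>\<omega>. (W (k2, 0) \<omega>, W (k3, 0) \<omega>, S \<omega>)) =
    distr M borel (W (k2, 0)) \<Otimes>\<^sub>M distr M (borel \<Otimes>\<^sub>M N) (\<lambda>\<omega>. (W (k3, 0) \<omega>, S \<omega>))"
    using distr_pair_coordinates[OF W, of ?A2 "- ?A2" "\<lambda>w. w (k2, 0)" borel
        "\<lambda>w. (w (k3, 0), ?s w)" "borel \<Otimes>\<^sub>M N"] k
    by (simp add: S_def coord shift measurable_Pair)
  also have "distr M (borel \<Otimes>\<^sub>M N) (\<lambda>\<omega>. (W (k3, 0) \<omega>, S \<omega>)) =
    distr M borel (W (k3, 0)) \<Otimes>\<^sub>M distr M N S"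
    using distr_pair_coordinates[OF W, of ?A3 "- ?A3" "\<lambda>w. w (k3, 0)" borel ?s N] k
    by (simp add: S_def coord shift)
  finally show ?thesis .
qed

text \<open>Independence makes both joint laws products of their marginals, and a marginal depends
  on the kind of input only, not on the index being shifted.\<close>

lemma (in prob_space) distr_shift_inputs:
  fixes W :: "'k \<times> nat \<Rightarrow> 'a \<Rightarrow> real"
  assumes W: "indep_vars (\<lambda>_. borel) W UNIV"
    and D: "\<And>k n. distr M borel (W (k, n)) = D k"
  shows "distr M (\<Pi>\<^sub>M i\<in>UNIV. borel) (\<lambda>\<omega> i. W (fst i, Suc (snd i)) \<omega>) =
         distr M (\<Pi>\<^sub>M i\<in>UNIV. borel) (\<lambda>\<omega> i. W i \<omega>)"
proof -
  let ?f = "\<lambda>i. (fst i, Suc (snd i)) :: 'k \<times> nat"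
  have rv: "random_variable borel (W i)" for i
    using W unfolding indep_vars_def by blast
  \<comment> \<open>The map \<open>?f\<close> is injective, so the singletons \<open>{?f j}\<close>
    are disjoint blocks and reindexing preserves independence.\<close>
  have "indep_vars (\<lambda>j. \<Pi>\<^sub>M i\<in>{?f j}. borel) (\<lambda>j \<omega>. restrict (\<lambda>i. W i \<omega>) {?f j}) UNIV"
    by (rule indep_vars_restrict[OF W]) (auto simp: disjoint_family_on_def)
  then have "indep_vars (\<lambda>_. borel) (\<lambda>j \<omega>. restrict (\<lambda>i. W i \<omega>) {?f j} (?f j)) UNIV"
    by (rule indep_vars_compose2[where Y = "\<lambda>j w. w (?f j)"]) simp
  then have shifted: "indep_vars (\<lambda>_. borel) (\<lambda>i. W (?f i)) UNIV"
    by simp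
  have D': "distr M borel (W i) = D (fst i)" for i
    using D[of "fst i" "snd i"] by simp
  have "distr M (\<Pi>\<^sub>M i\<in>UNIV. borel) (\<lambda>\<omega> i. W (?f i) \<omega>) = (\<Pi>\<^sub>M i\<in>UNIV. distr M borel (W (?f i)))"
    using shifted rv indep_vars_iff_distr_eq_PiM[where I = UNIV and M' = "\<lambda>_. borel" and X = "\<lambda>i. W (?f i)"]
    by (simp add: restrict_def)
  also have "\<dots> = (\<Pi>\<^sub>M i\<in>UNIV. distr M borel (W i))"
    by (simp add: D')
  also have "\<dots> = distr M (\<Pi>\<^sub>M i\<in>UNIV. borel) (\<lambda>\<omega> i. W i \<omega>)"
    using W rv indep_vars_iff_distr_eq_PiM[where I = UNIV and M' = "\<lambda>_. borel" and X = W]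
    by (simp add: restrict_def)
  finally show ?thesis .
qed

section \<open>Tails and atoms of distributions on the line\<close>

lemma (in real_distribution) measure_greaterThan_eq_cdf: "measure M {t<..} = 1 - cdf M t"
proof -
  have "{t<..} = space M - {..t}" by auto
  then show ?thesis using prob_compl[of "{..t}"] by (simp add: cdf_def)
qed

text \<open>The discontinuities of \<open>cdf P\<close> are the atoms of \<open>P\<close>. They are
  countably many, and each has \<open>Q\<close>-mass zero because \<open>cdf Q\<close> is continuous
  there.\<close>

lemma AE_isCont_cdf:
  assumes "real_distribution P" "real_distribution Q"
    and "\<And>t. isCont (cdf P) t \<or> isCont (cdf Q) t"
  shows "AE t in Q. isCont (cdf P) t"
proof -
  interpret P: real_distribution P by fact
  interpret Q: real_distribution Q by fact
  let ?D = "{t. measure P {t} > 0}"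
  have "?D = {t. \<not> isCont (cdf P) t}"
    using P.isCont_cdf by (simp add: less_le)
  moreover have "(\<Union>t\<in>?D. {t}) \<in> null_sets Q"
  proof (rule null_sets_UN')
    show "countable ?D" by (rule P.countable_atoms)
    fix t assume "t \<in> ?D"
    then have "\<not> isCont (cdf P) t" by (simp add: P.isCont_cdf)
    then have "measure Q {t} = 0" using assms(3) Q.isCont_cdf by blast
    then show "{t} \<in> null_sets Q" by (simp add: null_sets_def Q.emeasure_eq_measure)
  qed
  ultimately have "{t. \<not> isCont (cdf P) t} \<in> null_sets Q" by simp
  then show ?thesis
    by (rule AE_I'[of _ Q]) auto
qed

text \<open>Ties go to the claim, so the claim term involves a closed tail; continuity at
  \<open>t\<close> removes the mass of the endpoint.\<close>

lemma (in real_distribution) measure_atLeast_eq_cdf: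
  assumes "isCont (cdf M) t"
  shows "measure M {t..} = 1 - cdf M t"
proof -
  have "{t..} = {t} \<union> {t<..}" by auto
  then have "measure M {t..} = measure M {t} + measure M {t<..}"
    using finite_measure_Union[of "{t}" "{t<..}"] by simp
  then show ?thesis using assms isCont_cdf measure_greaterThan_eq_cdf by simp
qed

section \<open>The integral equation for the non-ruin probability\<close>

theorem theorem6p2:
  fixes M :: "'a measure"
    and F G Kc Kp :: "real \<Rightarrow> real"
    and c :: "real \<Rightarrow> real" and U :: "real \<Rightarrow> real \<Rightarrow> real"
    and \<tau>p \<tau>c X Y :: "nat \<Rightarrow> 'a \<Rightarrow> real"
  assumes "prob_space M"
    and "prob_space.indep_vars M (\<lambda>_. borel) (risk_inputs \<tau>p \<tau>c X Y) UNIV"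
    and "\<And>i \<omega>. \<omega> \<in> space M \<Longrightarrow> 0 \<le> risk_inputs \<tau>p \<tau>c X Y i \<omega>"
    and "\<And>n. cdf (distr M borel (\<tau>p n)) = Kp"
    and "\<And>n. cdf (distr M borel (\<tau>c n)) = Kc"
    and "\<And>n. cdf (distr M borel (X n)) = G"
    and "\<And>n. cdf (distr M borel (Y n)) = F"
    and "\<And>x. 0 \<le> x \<Longrightarrow> 0 \<le> c x"
    and "piecewise_continuous_nonneg c"
    and "unique_cauchy_flow c U"
    and "\<And>t. isCont Kp t \<or> isCont Kc t"
    and "\<And>t. 0 \<le> t \<Longrightarrow> Kp t < 1"
    and "\<And>t. 0 \<le> t \<Longrightarrow> Kc t < 1"
  shows "let \<phi> = nonruin_probability M U \<tau>p \<tau>c X Y in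
    \<forall>u\<ge>0. \<phi> u =
      (LINT t:{0..}|interval_measure Kc.
         (LINT z:{0..U u t}|interval_measure F. \<phi> (U u t - z)) * (1 - Kp t)) +
      (LINT t:{0..}|interval_measure Kp.
         (LINT z:{0..}|interval_measure G. \<phi> (U u t + z)) * (1 - Kc t))"
proof -
  interpret prob_space M by fact
  let ?W = "risk_inputs \<tau>p \<tau>c X Y"
  let ?N = "\<Pi>\<^sub>M i\<in>(UNIV :: (input_kind \<times> nat) set). (borel :: real measure)"
  let ?S = "\<lambda>\<omega> i. ?W (fst i, Suc (snd i)) \<omega>"
  define \<phi> where "\<phi> = nonruin_probability M U \<tau>p \<tau>c X Y"
  define \<nu> where "\<nu> = distr M ?N (\<lambda>\<omega> i. ?W i \<omega>)"
  note W = assms(2) and pos = assms(3) and flow = assms(10)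
  have rv[measurable]: "random_variable borel (?W i)" for i
    using W unfolding indep_vars_def by blast
  have rvs: "random_variable borel (\<tau>p n)" "random_variable borel (\<tau>c n)"
      "random_variable borel (X n)" "random_variable borel (Y n)" for n
    using rv[of "(Premium_Time, n)"] rv[of "(Claim_Time, n)"]
      rv[of "(Premium_Size, n)"] rv[of "(Claim_Size, n)"] by auto
  have law: "distr M borel V = interval_measure K"
    if "random_variable borel V" "cdf (distr M borel V) = K" for V K
    using real_distribution.interval_measure_cdf[OF real_distribution_distr[OF that(1)]] that(2) by simp
  have laws: "distr M borel (\<tau>p n) = interval_measure Kp" "distr M borel (\<tau>c n) = interval_measure Kc"
      "distr M borel (X n) = interval_measure G" "distr M borel (Y n) = interval_measure F" for n
    using law rvs assms(4-7) by auto
  have rd: "real_distribution (interval_measure Kp)" "real_distribution (interval_measure Kc)"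
      "real_distribution (interval_measure G)" "real_distribution (interval_measure F)"
    using real_distribution_distr rvs laws by metis+
  have cdfs: "cdf (interval_measure Kp) = Kp" "cdf (interval_measure Kc) = Kc"
    using laws assms(4,5) by metis+
  have AE_nonneg: "AE t in distr M borel V. 0 \<le> t"
    if "random_variable borel V" "\<And>\<omega>. \<omega> \<in> space M \<Longrightarrow> 0 \<le> V \<omega>" for V :: "'a \<Rightarrow> real"
    using that by (subst AE_distr_iff) auto
  have nonneg: "0 \<le> \<tau>p n \<omega>" "0 \<le> \<tau>c n \<omega>" "0 \<le> X n \<omega>" "0 \<le> Y n \<omega>" if "\<omega> \<in> space M" for n \<omega>
    using pos[OF that, of "(Premium_Time, n)"] pos[OF that, of "(Claim_Time, n)"]
      pos[OF that, of "(Premium_Size, n)"] pos[OF that, of "(Claim_Size, n)"] by simp_all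
  \<comment> \<open>These allow the indicators of \<open>{0..}\<close> in the stated integrals to be
    inserted or dropped almost everywhere.\<close>
  have AE_pos: "AE t in interval_measure Kp. 0 \<le> t" "AE t in interval_measure Kc. 0 \<le> t"
      "AE t in interval_measure G. 0 \<le> t" "AE t in interval_measure F. 0 \<le> t"
    using AE_nonneg[OF rvs(1) nonneg(1)] AE_nonneg[OF rvs(2) nonneg(2)]
      AE_nonneg[OF rvs(3) nonneg(3)] AE_nonneg[OF rvs(4) nonneg(4)]
    unfolding laws by simp_all
  have Wm[measurable]: "random_variable ?N (\<lambda>\<omega> i. ?W i \<omega>)"
    by (rule measurable_PiM_single') auto
  have Sm[measurable]: "random_variable ?N ?S"
    by (rule measurable_PiM_single') auto
  \<comment> \<open>The inputs after the first jump have the law of the whole sequence; this is what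
    makes \<open>\<phi>\<close> reappear under the integrals.\<close>
  have \<nu>: "distr M ?N ?S = \<nu>"
    unfolding \<nu>_def
    by (rule distr_shift_inputs[OF W, where D = "\<lambda>k. case k of Premium_Time \<Rightarrow> interval_measure Kp
        | Claim_Time \<Rightarrow> interval_measure Kc | Premium_Size \<Rightarrow> interval_measure G
        | Claim_Size \<Rightarrow> interval_measure F"])
       (auto simp: laws split: input_kind.split)
  interpret \<nu>: prob_space \<nu>
    unfolding \<nu>_def by (rule prob_space_distr) simp
  have sets_\<nu>[measurable_cong]: "sets \<nu> = sets ?N" by (simp add: \<nu>_def)
  have A[measurable]: "survival_set U \<in> sets (borel \<Otimes>\<^sub>M ?N)"
    by (rule survival_set_measurable[OF flow])
  have event: "(\<forall>t\<ge>0. 0 \<le> capital U \<tau>p \<tau>c X Y u \<omega> t) \<and> (\<forall>n. 0 \<le> post_jump_capital U \<tau>p \<tau>c X Y u \<omega> n)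
      \<longleftrightarrow> (u, \<lambda>i. ?W i \<omega>) \<in> survival_set U" if "\<omega> \<in> space M" for u \<omega>
    using capital_nonneg[OF flow, where \<tau>p = \<tau>p and \<tau>c = \<tau>c and X = X and Y = Y and u = u and \<omega> = \<omega>]
    by (auto simp: survival_set_def post_jump_capital_eq_input_capital[OF pos[OF that], symmetric])
  have \<phi>_expectation: "\<phi> u = expectation (\<lambda>\<omega>. indicator (survival_set U) (u, \<lambda>i. ?W i \<omega>))" for u
  proof -
    have m: "{\<omega> \<in> space M. (u, \<lambda>i. ?W i \<omega>) \<in> survival_set U} \<in> events"
      by measurable
    have "\<phi> u = prob {\<omega> \<in> space M. (u, \<lambda>i. ?W i \<omega>) \<in> survival_set U}"
      unfolding \<phi>_def nonruin_probability_def using event by (metis (mono_tags, lifting) Collect_cong)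
    also have "\<dots> = expectation (indicator {\<omega> \<in> space M. (u, \<lambda>i. ?W i \<omega>) \<in> survival_set U})"
      using m by simp
    also have "\<dots> = expectation (\<lambda>\<omega>. indicator (survival_set U) (u, \<lambda>i. ?W i \<omega>))"
      by (intro Bochner_Integration.integral_cong) (auto simp: indicator_def)
    finally show ?thesis .
  qed
  have \<phi>_\<nu>: "(\<integral>s. indicat_real (survival_set U) (u, s) \<partial>\<nu>) = \<phi> u" for u
    unfolding \<phi>_expectation \<nu>_def by (subst integral_distr) auto
  \<comment> \<open>Joint measurability of the survival set makes its section probabilities, and
    hence \<open>\<phi>\<close>, Borel in the capital.\<close>
  have "(\<lambda>v. \<integral>s. indicat_real (survival_set U) (v, s) \<partial>\<nu>) \<in> borel_measurable borel"
    by measurable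
  then have \<phi>m[measurable]: "\<phi> \<in> borel_measurable borel"
    by (simp add: \<phi>_\<nu>)
  \<comment> \<open>Since \<open>\<phi>\<close> vanishes at negative capital, the claim integral can
    later be cut off at \<open>U u t\<close>.\<close>
  have \<phi>_nonzeroD: "0 \<le> v" if "\<phi> v \<noteq> 0" for v
    using that by (rule contrapos_np) (simp add: \<phi>_expectation survival_set_step[of v])
  have "\<phi> u =
      (LINT t:{0..}|interval_measure Kc.
         (LINT z:{0..U u t}|interval_measure F. \<phi> (U u t - z)) * (1 - Kp t)) +
      (LINT t:{0..}|interval_measure Kp.
         (LINT z:{0..}|interval_measure G. \<phi> (U u t + z)) * (1 - Kc t))" if u: "0 \<le> u" for u
  proof -
    interpret Kp: real_distribution "interval_measure Kp" by (rule rd)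
    interpret Kc: real_distribution "interval_measure Kc" by (rule rd)
    interpret G: real_distribution "interval_measure G" by (rule rd)
    interpret F: real_distribution "interval_measure F" by (rule rd)
    have [measurable]: "Kp \<in> borel_measurable borel" "Kc \<in> borel_measurable borel"
      using Kp.cdf_nondecreasing Kc.cdf_nondecreasing
      by (auto intro!: borel_measurable_mono monoI simp: cdfs)
    \<comment> \<open>The closed tail decreases in \<open>t\<close>, so its negative is monotone and
      therefore Borel.\<close>
    have "(\<lambda>t. - measure (interval_measure Kp) {t'. t \<le> t'}) \<in> borel_measurable borel"
      by (auto intro!: borel_measurable_mono monoI Kp.finite_measure_mono)
    then have [measurable]: "(\<lambda>t. measure (interval_measure Kp) {t'. t \<le> t'}) \<in> borel_measurable borel"
      by simp
    \<comment> \<open>A version of \<open>U u\<close> that is Borel on the whole line and agrees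
      with it at nonnegative times.\<close>
    let ?V = "\<lambda>t. drift U u (max 0 t)"
    have Vm[measurable]: "?V \<in> borel_measurable borel"
      using measurable_compose[OF _ drift_flow_measurable[OF flow], of "\<lambda>t. (u, t)" borel] by simp
    have V: "?V t = U u t" if "0 \<le> t" for t using u that by (simp add: drift_def max_absorb2)
    have [measurable]: "(\<lambda>t. \<integral>z. \<phi> (?V t + z) \<partial>interval_measure G) \<in> borel_measurable borel"
      "(\<lambda>t. \<integral>z. \<phi> (?V t - z) \<partial>interval_measure F) \<in> borel_measurable borel"
      by measurable
    \<comment> \<open>\<open>?p\<close> is survival with a premium first and \<open>?c\<close>
      survival with a claim first; the conditions on the clocks are complementary, with ties in
      \<open>?c\<close>.\<close>
    let ?p = "\<lambda>\<omega>. of_bool (\<tau>p 0 \<omega> < \<tau>c 0 \<omega>) * indicat_real (survival_set U) (?V (\<tau>p 0 \<omega>) + X 0 \<omega>, ?S \<omega>)"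
    let ?c = "\<lambda>\<omega>. of_bool (\<tau>c 0 \<omega> \<le> \<tau>p 0 \<omega>) * indicat_real (survival_set U) (?V (\<tau>c 0 \<omega>) - Y 0 \<omega>, ?S \<omega>)"
    note [measurable] = rvs
    have int: "integrable M ?p" "integrable M ?c"
      by (rule integrable_const_bound[where B = 1]; auto simp: indicator_def; measurable)+
    have "{p \<in> space (borel \<Otimes>\<^sub>M borel). fst p < (snd p :: real)} \<in> sets (borel \<Otimes>\<^sub>M borel)"
      "{p \<in> space (borel \<Otimes>\<^sub>M borel). fst p \<le> (snd p :: real)} \<in> sets (borel \<Otimes>\<^sub>M borel)"
      by measurable
    then have R: "{p. fst p < (snd p :: real)} \<in> sets (borel \<Otimes>\<^sub>M borel)"
      "{p. fst p \<le> (snd p :: real)} \<in> sets (borel \<Otimes>\<^sub>M borel)"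
      by (simp_all add: space_pair_measure)
    have "\<phi> u = expectation (\<lambda>\<omega>. ?c \<omega> + ?p \<omega>)"
      unfolding \<phi>_expectation
      by (intro Bochner_Integration.integral_cong refl)
         (auto simp: indicator_def survival_set_step[of u] u input_capital_Suc Let_def min_def)
    also have "\<dots> = expectation ?c + expectation ?p"
      using int by simp
    also have "expectation ?p = (\<integral>t. (\<integral>z. \<phi> (?V t + z) \<partial>interval_measure G)
         * measure (interval_measure Kc) {t'. t < t'} \<partial>interval_measure Kp)"
      using expectation_first_jump[OF rvs(1,2,3) Sm
          distr_first_inputs[OF W, of Premium_Time Claim_Time Premium_Size, simplified],
          where R = "(<)" and A = "survival_set U" and h = "\<lambda>t z. ?V t + z"]
      by (simp add: \<nu> \<phi>_\<nu> laws R)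
    \<comment> \<open>The two clocks exchange roles, and \<open>R\<close> is now the weak inequality
      because a tie produces a claim.\<close>
    also have "expectation ?c = (\<integral>t. (\<integral>z. \<phi> (?V t - z) \<partial>interval_measure F)
         * measure (interval_measure Kp) {t'. t \<le> t'} \<partial>interval_measure Kc)"
      using expectation_first_jump[OF rvs(2,1,4) Sm
          distr_first_inputs[OF W, of Claim_Time Premium_Time Claim_Size, simplified],
          where R = "(\<le>)" and A = "survival_set U" and h = "\<lambda>t z. ?V t - z"]
      by (simp add: \<nu> \<phi>_\<nu> laws R)
    also have "(\<integral>t. (\<integral>z. \<phi> (?V t + z) \<partial>interval_measure G)
         * measure (interval_measure Kc) {t'. t < t'} \<partial>interval_measure Kp) =
      (LINT t:{0..}|interval_measure Kp. (LINT z:{0..}|interval_measure G. \<phi> (U u t + z)) * (1 - Kc t))"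
    proof -
      have inner: "(LINT z:{0..}|interval_measure G. \<phi> (U u t + z)) = (\<integral>z. \<phi> (?V t + z) \<partial>interval_measure G)"
        if "0 \<le> t" for t
        unfolding set_lebesgue_integral_def V[OF that]
        by (rule integral_cong_AE) (use AE_pos(3) in \<open>auto elim!: eventually_mono\<close>)
      \<comment> \<open>\<open>inner\<close> is available only for \<open>0 \<le> t\<close>;
        elsewhere both sides vanish through the indicator.\<close>
      have eq: "indicator {0..} t *\<^sub>R ((LINT z:{0..}|interval_measure G. \<phi> (U u t + z)) * (1 - Kc t)) =
          indicator {0..} t *\<^sub>R ((\<integral>z. \<phi> (?V t + z) \<partial>interval_measure G) * (1 - Kc t))" for t
        using inner[of t] by (simp add: indicator_def)
      have "measure (interval_measure Kc) {t'. t < t'} = 1 - Kc t" for t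
        using real_distribution.measure_greaterThan_eq_cdf[OF rd(2), of t]
        by (simp add: cdfs greaterThan_def)
      then show ?thesis
        unfolding set_lebesgue_integral_def[where A = "{0..}" and M = "interval_measure Kp"] eq
        by (intro integral_cong_AE) (use AE_pos(1) in \<open>auto elim!: eventually_mono\<close>)
    qed
    also have "(\<integral>t. (\<integral>z. \<phi> (?V t - z) \<partial>interval_measure F)
         * measure (interval_measure Kp) {t'. t \<le> t'} \<partial>interval_measure Kc) =
      (LINT t:{0..}|interval_measure Kc. (LINT z:{0..U u t}|interval_measure F. \<phi> (U u t - z)) * (1 - Kp t))"
    proof -
      \<comment> \<open>Below \<open>0\<close> there is no mass of the claim law, and above
        \<open>U u t\<close> the integrand vanishes by \<open>\<phi>_nonzeroD\<close>.\<close>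
      have inner: "(LINT z:{0..U u t}|interval_measure F. \<phi> (U u t - z)) = (\<integral>z. \<phi> (?V t - z) \<partial>interval_measure F)"
        if "0 \<le> t" for t
        unfolding set_lebesgue_integral_def V[OF that]
        by (rule integral_cong_AE)
           (use AE_pos(4) in \<open>auto elim!: eventually_mono simp: indicator_def dest!: \<phi>_nonzeroD\<close>)
      have eq: "indicator {0..} t *\<^sub>R ((LINT z:{0..U u t}|interval_measure F. \<phi> (U u t - z)) * (1 - Kp t)) =
          indicator {0..} t *\<^sub>R ((\<integral>z. \<phi> (?V t - z) \<partial>interval_measure F) * (1 - Kp t))" for t
        using inner[of t] by (simp add: indicator_def)
      \<comment> \<open>The tail formula for \<open>Kp\<close> may fail at its atoms, but the outer
        integral is with respect to \<open>Kc\<close>, which does not charge them.\<close>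
      have "AE t in interval_measure Kc. isCont Kp t"
        using AE_isCont_cdf[OF rd(1,2)] assms(11) by (simp add: cdfs)
      then have "AE t in interval_measure Kc. measure (interval_measure Kp) {t'. t \<le> t'} = 1 - Kp t"
        using real_distribution.measure_atLeast_eq_cdf[OF rd(1)]
        by (auto simp: cdfs atLeast_def elim!: eventually_mono)
      then show ?thesis
        unfolding set_lebesgue_integral_def[where A = "{0..}" and M = "interval_measure Kc"] eq
        by (intro integral_cong_AE) (use AE_pos(2) in \<open>auto elim: eventually_elim2\<close>)
    qed
    finally show ?thesis .
  qed
  then show ?thesis unfolding \<phi>_def by simp
qed

end
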